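(* Let $k\ge 4$ be an integer, let $\mathbf u=(1/k,\dots,1/k)$ be the uniform law on $k$ points, and put $$m_k:=\frac1k-\psi_k(1/k)=\frac{(1-1/k)^k}{k-1}=\frac{(k-1)^{k-1}}{k^k}>0.$$ Every probability vector $p\in\mathbb R^k$ satisfying $\lVert p-\mathbf u\rVert_\infty<m_k/2$ belongs to $\mathcal B_k$. Consequently $\mathbf u$ is a relative-interior point of $\mathcal B_k$ in the probability simplex. More quantitatively, if volume is normalized so that the whole $(k-1)$-dimensional probability simplex has volume one, then $$\operatorname{vol}_{k-1}(\mathcal B_k)\ge\left(\frac{(k-1)^{k-1}}{2k^k}\right)^{k-1}>0 .$$
   Context: For an integer $k\ge 2$ and $t\in[0,1]$ put $\psi_k(t):=\dfrac{1-t-(1-t)^k}{k-1}$. For a probability law $p$ on $k$ points, let $p_1^{\downarrow}\ge p_2^{\downarrow}\ge\cdots\ge p_k^{\downarrow}$ be its atoms sorted in decreasing order (with multiplicity). The body $\mathcal B_k$ is the set of probability laws $p$ on $k$ points (a subset of the probability simplex $\Delta_{k-1}\subset\mathbb R^k$) with $p_k^{\downarrow}\ge\psi_k(p_2^{\downarrow})$. Volume $\operatorname{vol}_{k-1}$ is $(k-1)$-dimensional relative volume in the affine hull of $\Delta_{k-1}$. *)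

theory Defs
  imports "HOL-Analysis.Analysis" "HOL-Library.Multiset"
begin

text \<open>Laws on \<open>k\<close> points are vectors in \<open>real^'n\<close> with \<open>k = CARD('n)\<close>.\<close>

definition psi :: "nat \<Rightarrow> real \<Rightarrow> real" where
  "psi k t = (1 - t - (1 - t) ^ k) / (real k - 1)"

definition prob_simplex :: "(real ^ 'n) set" where
  "prob_simplex = {p. (\<forall>i. 0 \<le> p $ i) \<and> (\<Sum>i\<in>UNIV. p $ i) = 1}"

text \<open>The \<open>j\<close>-th largest coordinate counted with multiplicity; only meaningful for
  \<open>1 \<le> j \<le> CARD('n)\<close>.\<close>

definition desc_atom :: "real ^ 'n \<Rightarrow> nat \<Rightarrow> real" where
  "desc_atom p j =
     rev (sorted_list_of_multiset (image_mset (\<lambda>i. p $ i) (mset_set UNIV))) ! (j - 1)"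

definition body :: "(real ^ 'n) set" where
  "body = {p \<in> prob_simplex. desc_atom p CARD('n) \<ge> psi CARD('n) (desc_atom p 2)}"

definition uniform_law :: "real ^ 'n" where
  "uniform_law = (\<chi> i. 1 / real CARD('n))"

definition margin :: "nat \<Rightarrow> real" where
  "margin k = 1 / real k - psi k (1 / real k)"

text \<open>Lebesgue measure on the affine subspace \<open>a + span B\<close> for an orthonormal set \<open>B\<close>, in the
  same way as \<open>lborel\<close> is built from \<open>Basis\<close>. It lives on the ambient Borel sets.\<close>

definition affine_lborel :: "'a \<Rightarrow> 'a set \<Rightarrow> 'a::euclidean_space measure" where
  "affine_lborel a B = distr (\<Pi>\<^sub>M b\<in>B. lborel) borel (\<lambda>f. a + (\<Sum>b\<in>B. f b *\<^sub>R b))"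

definition orthonormal_basis_of :: "'a::euclidean_space set \<Rightarrow> 'a set \<Rightarrow> bool" where
  "orthonormal_basis_of B V \<longleftrightarrow>
     pairwise orthogonal B \<and> (\<forall>b\<in>B. norm b = 1) \<and> span B = V"

text \<open>Volume relative to a nonempty affine subspace \<open>A\<close>, of dimension \<open>aff_dim A\<close>. The value does
  not depend on the chosen base point and orthonormal basis of the direction space of \<open>A\<close>.\<close>

definition affine_volume :: "'a::euclidean_space set \<Rightarrow> 'a set \<Rightarrow> real" where
  "affine_volume A S =
     measure (affine_lborel (SOME a. a \<in> A)
       (SOME B. orthonormal_basis_of B {x - y |x y. x \<in> A \<and> y \<in> A})) S"

definition normalized_volume :: "(real ^ 'n) set \<Rightarrow> real" where
  "normalized_volume S =
     (let \<Delta> = (prob_simplex :: (real ^ 'n) set)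
      in affine_volume (affine hull \<Delta>) S / affine_volume (affine hull \<Delta>) \<Delta>)"

end

theory Submission
  imports Defs
begin

text \<open>
  At the uniform law both atoms in the defining inequality of the body equal \<open>1 / k\<close>, and the
  inequality holds with slack \<open>margin k\<close>. On the unit interval \<open>psi k\<close> is Lipschitz with constant 1
  (lemma \<open>psi_lipschitz\<close>), so moving every coordinate by less than half of the margin
  cannot use up the slack (lemma \<open>near_uniform_in_body\<close>). The margin is at most \<open>1 / k\<close>, so such a
  move within the affine hull also keeps all coordinates nonnegative, which yields both
  interior statements.

  For the volume, let \<open>c\<close> be half of the margin. Coordinates of probability laws differ from
  \<open>1 / k\<close> by less than 1, hence the homothety with centre at the uniform law and ratio \<open>c\<close> maps the
  whole simplex into the body (lemma \<open>homothety_simplex_in_body\<close>). A homothety of ratio \<open>c\<close> scales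
  volume in dimension \<open>k - 1\<close> by \<open>c ^ (k - 1)\<close>, which is the asserted bound after
  normalization.

  What remains is measure theory of affine subspaces. In the orthonormal chart the measure is a
  finite product of one-dimensional Lebesgue measures, and a homothety acts on each
  coordinate by an affine map (lemma \<open>affine_lborel_homothety\<close>). Dividing by the volume of the
  simplex requires it to be positive and finite: it contains a relative ball
  (lemma \<open>affine_lborel_pos\<close>) and is bounded (lemma \<open>affine_lborel_bounded_finite\<close>). Finally the
  body has to be measurable, which follows from \<open>closed_body\<close>.
\<close>

section \<open>The profile function\<close>

text \<open>
  With \<open>a = 1 - s\<close> and \<open>b = 1 - t\<close> the numerator of \<open>psi k s - psi k t\<close> is
  \<open>(a - b) * (1 - S)\<close>, where \<open>S\<close> is the sum of the \<open>k\<close> mixed monomials of degree \<open>k - 1\<close>.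
  Each monomial lies between 0 and 1, so \<open>1 - S\<close> lies between \<open>-(k - 1)\<close> and \<open>1\<close>, and the
  denominator \<open>k - 1\<close> is exactly what is needed for the constant 1.
\<close>

lemma psi_lipschitz:
  assumes "k \<ge> 2" and "0 \<le> s" "s \<le> 1" "0 \<le> t" "t \<le> 1"
  shows "\<bar>psi k s - psi k t\<bar> \<le> \<bar>s - t\<bar>"
proof -
  define a b where "a = 1 - s" and "b = 1 - t"
  define S where "S = (\<Sum>i<k. b ^ (k - Suc i) * a ^ i)"
  have ab: "0 \<le> a" "a \<le> 1" "0 \<le> b" "b \<le> 1"
    using assms by (auto simp: a_def b_def)
  have diff: "a ^ k - b ^ k = (a - b) * S"
    unfolding S_def by (rule power_diff_sumr2)
  have "0 \<le> S"
    unfolding S_def using ab by (intro sum_nonneg mult_nonneg_nonneg) auto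
  moreover have "S \<le> (\<Sum>i<k. 1)"
    unfolding S_def using ab by (intro sum_mono mult_le_one power_le_one) auto
  ultimately have S: "\<bar>1 - S\<bar> \<le> real k - 1"
    using assms(1) by auto
  have "psi k s - psi k t = (a - b) * (1 - S) / (real k - 1)"
    using diff by (simp add: psi_def a_def b_def diff_divide_distrib [symmetric] algebra_simps)
  then have "\<bar>psi k s - psi k t\<bar> = \<bar>a - b\<bar> * (\<bar>1 - S\<bar> / (real k - 1))"
    using assms(1) by (simp add: abs_mult)
  also have "\<dots> \<le> \<bar>a - b\<bar> * 1"
    using S assms(1) by (intro mult_left_mono) auto
  finally show ?thesis
    by (simp add: a_def b_def)
qed

lemma margin_eq:
  assumes "k \<ge> 2"
  shows "margin k = (1 - 1 / real k) ^ k / (real k - 1)"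
proof -
  have "(1 - 1 / real k) / (real k - 1) = 1 / real k"
    using assms by (simp add: divide_simps)
  then show ?thesis
    by (simp add: margin_def psi_def diff_divide_distrib)
qed

lemma margin_closed_form:
  assumes "k \<ge> 2"
  shows "(1 - 1 / real k) ^ k / (real k - 1) = (real k - 1) ^ (k - 1) / real k ^ k"
proof -
  have "1 - 1 / real k = (real k - 1) / real k"
    using assms by (simp add: divide_simps)
  moreover have "(real k - 1) ^ k = (real k - 1) * (real k - 1) ^ (k - 1)"
    using assms by (cases k) auto
  ultimately show ?thesis
    using assms by (simp add: power_divide)
qed

lemma margin_pos: "k \<ge> 2 \<Longrightarrow> 0 < margin k"
  by (simp add: margin_eq margin_closed_form)

lemma margin_le:
  assumes "k \<ge> 2"
  shows "margin k \<le> 1 / real k"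
proof -
  have "(1 - 1 / real k) ^ k \<le> (1 - 1 / real k) ^ 1"
    using assms by (intro power_decreasing) auto
  then have "0 \<le> psi k (1 / real k)"
    using assms by (auto simp: psi_def intro!: divide_nonneg_nonneg)
  then show ?thesis
    by (simp add: margin_def)
qed

section \<open>The sorted atoms and the body\<close>

lemma desc_atom_eqI:
  fixes p :: "real ^ 'n::finite"
  assumes "sorted xs" and "mset xs = image_mset (\<lambda>i. p $ i) (mset_set UNIV)"
  shows "desc_atom p j = rev xs ! (j - 1)"
proof -
  have "sorted_list_of_multiset (mset xs) = xs"
    using assms(1) by (simp add: sorted_sort_id)
  then show ?thesis
    by (simp add: desc_atom_def assms(2))
qed

lemma desc_atom_last:
  fixes p :: "real ^ 'n::finite"
  shows "desc_atom p CARD('n) = Min (range (($) p))"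
proof -
  define xs where "xs = sorted_list_of_multiset (image_mset (\<lambda>i. p $ i) (mset_set UNIV))"
  have m: "mset xs = image_mset (\<lambda>i. p $ i) (mset_set UNIV)"
    by (simp add: xs_def)
  have s: "sorted xs"
    unfolding xs_def by blast
  have set: "set xs = range (($) p)"
    by (simp add: xs_def)
  have len: "length xs = CARD('n)"
    using arg_cong[OF m, of size] by simp
  then have "xs \<noteq> []"
    using finite_UNIV_card_ge_0[where 'a = 'n] by auto
  have "desc_atom p CARD('n) = rev xs ! (length xs - 1)"
    using desc_atom_eqI[OF s m] len by simp
  also have "\<dots> = xs ! 0"
    using \<open>xs \<noteq> []\<close> by (subst rev_nth) auto
  also have "\<dots> = Min (set xs)"
  proof (rule Min_eqI [symmetric])
    show "xs ! 0 \<le> y" if "y \<in> set xs" for y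
      using that s by (metis in_set_conv_nth le0 sorted_nth_mono)
  qed (use \<open>xs \<noteq> []\<close> in auto)
  finally show ?thesis
    by (simp add: set)
qed

lemma desc_atom_2:
  fixes p :: "real ^ 'n::finite"
  assumes "i \<noteq> j" and "p $ j \<le> p $ i" and "\<And>l. l \<noteq> i \<Longrightarrow> p $ l \<le> p $ j"
  shows "desc_atom p 2 = p $ j"
proof -
  define xs where
    "xs = sorted_list_of_multiset (image_mset (\<lambda>i. p $ i) (mset_set (UNIV - {i, j})))"
  have "(UNIV :: 'n set) = insert i (insert j (UNIV - {i, j}))"
    by auto
  then have "mset_set (UNIV :: 'n set) = add_mset i (add_mset j (mset_set (UNIV - {i, j})))"
    using assms(1) by (metis (no_types, lifting) Diff_iff finite finite_insert insertE insertI1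
        insertI2 mset_set.insert)
  then have m: "mset (xs @ [p $ j, p $ i]) = image_mset (\<lambda>i. p $ i) (mset_set UNIV)"
    by (simp add: xs_def)
  have "x \<le> p $ j" if "x \<in> set xs" for x
    using that assms(3) by (auto simp: xs_def)
  then have "sorted (xs @ [p $ j, p $ i])"
    using assms(2) by (fastforce simp: sorted_append xs_def)
  from desc_atom_eqI[OF this m, of 2] show ?thesis
    by simp
qed

lemma exists_top_two:
  fixes p :: "real ^ 'n::finite"
  assumes "CARD('n) \<ge> 2"
  obtains i j where "i \<noteq> j" "p $ j \<le> p $ i" "\<And>l. l \<noteq> i \<Longrightarrow> p $ l \<le> p $ j"
proof -
  have "Max (range (($) p)) \<in> range (($) p)"
    by (intro Max_in) auto
  then obtain i where "Max (range (($) p)) = p $ i"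
    by (rule rangeE)
  then have i: "p $ l \<le> p $ i" for l
    using Max_ge[of "range (($) p)" "p $ l"] by simp
  have "card (UNIV - {i}) = CARD('n) - 1"
    by (simp add: card_Diff_singleton)
  then have ne: "UNIV - {i} \<noteq> {}"
    using assms by (metis Suc_1 card.empty diff_is_0_eq not_less_eq_eq order_refl)
  define M where "M = Max (($) p ` (UNIV - {i}))"
  have "M \<in> ($) p ` (UNIV - {i})"
    unfolding M_def using ne by (intro Max_in) auto
  then obtain j where j: "j \<noteq> i" "M = p $ j"
    by auto
  have "p $ l \<le> p $ j" if "l \<noteq> i" for l
    using that unfolding j(2) [symmetric] M_def by (intro Max_ge) auto
  with i j that show thesis
    by metis
qed

text \<open>
  Naming positions of the two largest atoms replaces the order statistics by a finite
  disjunction of weak inequalities between continuous functions of \<open>p\<close>. This makes the body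
  closed, hence Borel; without that, its volume could not be compared with that of a subset.
\<close>

lemma mem_body_iff:
  fixes p :: "real ^ 'n::finite"
  assumes "CARD('n) \<ge> 2"
  shows "p \<in> body \<longleftrightarrow> p \<in> prob_simplex \<and> (\<exists>i. \<exists>j\<in>-{i}. p $ j \<le> p $ i \<and>
    (\<forall>l\<in>-{i}. p $ l \<le> p $ j) \<and> (\<forall>l. psi CARD('n) (p $ j) \<le> p $ l))"
proof -
  have last: "psi CARD('n) t \<le> desc_atom p CARD('n) \<longleftrightarrow> (\<forall>l. psi CARD('n) t \<le> p $ l)" for t
    by (simp add: desc_atom_last)
  have body: "p \<in> body \<longleftrightarrow>
      p \<in> prob_simplex \<and> (\<forall>l. psi CARD('n) (desc_atom p 2) \<le> p $ l)"
    by (simp add: body_def last)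
  show ?thesis
  proof
    assume "p \<in> body"
    moreover obtain i j where ij: "i \<noteq> j" "p $ j \<le> p $ i" "\<And>l. l \<noteq> i \<Longrightarrow> p $ l \<le> p $ j"
      using exists_top_two[OF assms, of p] by metis
    ultimately have "p \<in> prob_simplex \<and> (\<forall>l. psi CARD('n) (p $ j) \<le> p $ l)"
      using desc_atom_2[OF ij] body by simp
    with ij show "p \<in> prob_simplex \<and> (\<exists>i. \<exists>j\<in>-{i}. p $ j \<le> p $ i \<and>
        (\<forall>l\<in>-{i}. p $ l \<le> p $ j) \<and> (\<forall>l. psi CARD('n) (p $ j) \<le> p $ l))"
      by (intro conjI exI[of _ i] bexI[of _ j]) auto
  next
    assume "p \<in> prob_simplex \<and> (\<exists>i. \<exists>j\<in>-{i}. p $ j \<le> p $ i \<and>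
        (\<forall>l\<in>-{i}. p $ l \<le> p $ j) \<and> (\<forall>l. psi CARD('n) (p $ j) \<le> p $ l))"
    then obtain i j where p: "p \<in> prob_simplex" and "j \<in> -{i}" and ij: "p $ j \<le> p $ i"
        "\<forall>l\<in>-{i}. p $ l \<le> p $ j" and psi: "\<forall>l. psi CARD('n) (p $ j) \<le> p $ l"
      by blast
    then have "desc_atom p 2 = p $ j"
      by (intro desc_atom_2[of i]) auto
    with p psi show "p \<in> body"
      using body by simp
  qed
qed

lemma closed_prob_simplex: "closed (prob_simplex :: (real ^ 'n::finite) set)"
  unfolding prob_simplex_def
  by (intro closed_Collect_conj closed_Collect_all closed_Collect_le closed_Collect_eq
      continuous_intros)

lemma closed_body:
  assumes "CARD('n::finite) \<ge> 2"
  shows "closed (body :: (real ^ 'n) set)"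
proof -
  have "closed {p :: real ^ 'n. p $ j \<le> p $ i \<and> (\<forall>l\<in>-{i}. p $ l \<le> p $ j) \<and>
      (\<forall>l. psi CARD('n) (p $ j) \<le> p $ l)}" for i j
    unfolding psi_def Ball_def using assms
    by (intro closed_Collect_conj closed_Collect_all closed_Collect_imp closed_Collect_le
        open_Collect_const continuous_intros) auto
  then have "closed (prob_simplex \<inter> (\<Union>i. \<Union>j\<in>-{i}. {p :: real ^ 'n. p $ j \<le> p $ i \<and>
      (\<forall>l\<in>-{i}. p $ l \<le> p $ j) \<and> (\<forall>l. psi CARD('n) (p $ j) \<le> p $ l)}))"
    by (intro closed_Int closed_prob_simplex closed_UN) auto
  also have "prob_simplex \<inter> (\<Union>i. \<Union>j\<in>-{i}. {p :: real ^ 'n. p $ j \<le> p $ i \<and>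
      (\<forall>l\<in>-{i}. p $ l \<le> p $ j) \<and> (\<forall>l. psi CARD('n) (p $ j) \<le> p $ l)}) = body"
    by (intro set_eqI) (simp add: mem_body_iff[OF assms] del: ball_simps)
  finally show ?thesis .
qed

lemma coordinate_le_one:
  fixes p :: "real ^ 'n::finite"
  assumes "p \<in> prob_simplex"
  shows "p $ i \<le> 1"
  using assms member_le_sum[of i UNIV "($) p"] by (simp add: prob_simplex_def)

text \<open>
  The margin is the slack in the defining inequality at the uniform law. The smallest atom uses
  less than half of it, and by the Lipschitz bound the threshold \<open>psi\<close> at the second atom
  uses less than the other half.
\<close>

lemma near_uniform_in_body:
  fixes p :: "real ^ 'n::finite"
  assumes "CARD('n) \<ge> 2" and p: "p \<in> prob_simplex"
    and near: "\<And>i. \<bar>p $ i - 1 / real CARD('n)\<bar> < margin CARD('n) / 2"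
  shows "p \<in> body"
proof -
  have "psi CARD('n) (p $ j) \<le> p $ l" for j l
  proof -
    have "\<bar>psi CARD('n) (p $ j) - psi CARD('n) (1 / real CARD('n))\<bar> \<le> \<bar>p $ j - 1 / real CARD('n)\<bar>"
      using assms(1) p coordinate_le_one[OF p]
      by (intro psi_lipschitz) (auto simp: prob_simplex_def)
    then show ?thesis
      using near[of j] near[of l] by (simp add: margin_def abs_if split: if_splits)
  qed
  then have psi: "psi CARD('n) t \<le> desc_atom p CARD('n)" if "t \<in> range (($) p)" for t
    using that by (auto simp: desc_atom_last)
  obtain i j where ij: "i \<noteq> j" "p $ j \<le> p $ i" "\<And>l. l \<noteq> i \<Longrightarrow> p $ l \<le> p $ j"
    using exists_top_two[OF assms(1), of p] by metis
  then have "desc_atom p 2 = p $ j"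
    by (rule desc_atom_2)
  then show ?thesis
    using psi p by (simp add: body_def)
qed

text \<open>Inside the hyperplane of total mass one, closeness to the uniform law already forces the
  coordinates to be positive, because the margin is at most \<open>1 / k\<close>.\<close>

lemma near_uniform_in_body':
  fixes p :: "real ^ 'n::finite"
  assumes "CARD('n) \<ge> 2" and "(\<Sum>i\<in>UNIV. p $ i) = 1"
    and near: "\<And>i. \<bar>p $ i - 1 / real CARD('n)\<bar> < margin CARD('n) / 2"
  shows "p \<in> body"
proof (rule near_uniform_in_body)
  have "0 \<le> p $ i" for i
    using near[of i] margin_le[OF assms(1)] margin_pos[OF assms(1)]
    by (auto simp: abs_if split: if_splits)
  then show "p \<in> prob_simplex"
    using assms(2) by (simp add: prob_simplex_def)
qed (use assms in auto)

lemma open_near_uniform: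
  "open {p :: real ^ 'n::finite. \<forall>i. \<bar>p $ i - 1 / real CARD('n)\<bar> < e}"
proof -
  have "open (\<Inter>i. {p :: real ^ 'n. \<bar>p $ i - 1 / real CARD('n)\<bar> < e})"
    by (intro open_INT ballI open_Collect_less continuous_intros) auto
  then show ?thesis
    by (simp add: Collect_all_eq)
qed

lemma uniform_law_in_simplex: "(uniform_law :: real ^ 'n::finite) \<in> prob_simplex"
  by (simp add: prob_simplex_def uniform_law_def)

lemma affine_hull_simplex_sum:
  fixes x :: "real ^ 'n::finite"
  assumes "x \<in> affine hull prob_simplex"
  shows "(\<Sum>i\<in>UNIV. x $ i) = 1"
proof -
  have "affine {x :: real ^ 'n. (\<Sum>i\<in>UNIV. x $ i) = 1}"
    by (simp add: affine_def sum.distrib sum_distrib_left [symmetric])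
  then have "affine hull prob_simplex \<subseteq> {x :: real ^ 'n. (\<Sum>i\<in>UNIV. x $ i) = 1}"
    by (intro hull_minimal) (auto simp: prob_simplex_def)
  with assms show ?thesis
    by blast
qed

lemma uniform_law_rel_interior:
  assumes "CARD('n::finite) \<ge> 2"
  shows "(uniform_law :: real ^ 'n) \<in> rel_interior body"
  unfolding mem_rel_interior
proof (intro exI conjI)
  let ?T = "{p :: real ^ 'n. \<forall>i. \<bar>p $ i - 1 / real CARD('n)\<bar> < margin CARD('n) / 2}"
  show "open ?T"
    by (rule open_near_uniform)
  show "uniform_law \<in> ?T \<inter> body"
    using near_uniform_in_body[OF assms uniform_law_in_simplex] margin_pos[OF assms]
    by (simp add: uniform_law_def)
  have "affine hull body \<subseteq> affine hull (prob_simplex :: (real ^ 'n) set)"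
    by (intro hull_mono) (auto simp: body_def)
  then show "?T \<inter> affine hull body \<subseteq> body"
    using near_uniform_in_body'[OF assms] affine_hull_simplex_sum by blast
qed

lemma uniform_law_interior_of:
  assumes "CARD('n::finite) \<ge> 2"
  shows "(uniform_law :: real ^ 'n) \<in> top_of_set prob_simplex interior_of body"
  unfolding interior_of_def mem_Collect_eq
proof (intro exI conjI)
  let ?T = "{p :: real ^ 'n. \<forall>i. \<bar>p $ i - 1 / real CARD('n)\<bar> < margin CARD('n) / 2}"
  show "openin (top_of_set prob_simplex) (prob_simplex \<inter> ?T)"
    using open_near_uniform by (rule openin_open_Int)
  show "uniform_law \<in> prob_simplex \<inter> ?T"
    using uniform_law_in_simplex margin_pos[OF assms] by (simp add: uniform_law_def)
  show "prob_simplex \<inter> ?T \<subseteq> body"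
    using near_uniform_in_body[OF assms] by blast
qed

section \<open>Lebesgue measure on an affine subspace\<close>

interpretation coordinate_lborel: product_sigma_finite "\<lambda>_. lborel"
  by (rule product_sigma_finite.intro) (rule sigma_finite_lborel)

lemma affine_chart_measurable:
  fixes a :: "'a::euclidean_space"
  shows "(\<lambda>f. a + (\<Sum>b\<in>B. f b *\<^sub>R b)) \<in> (\<Pi>\<^sub>M b\<in>B. lborel) \<rightarrow>\<^sub>M borel"
  by measurable

lemma sets_affine_lborel [simp]: "sets (affine_lborel a B) = sets borel"
  by (simp add: affine_lborel_def)

lemma emeasure_affine_lborel:
  assumes "S \<in> sets borel"
  shows "emeasure (affine_lborel a B) S =
    emeasure (\<Pi>\<^sub>M b\<in>B. lborel)
      ((\<lambda>f. a + (\<Sum>b\<in>B. f b *\<^sub>R b)) -` S \<inter> space (\<Pi>\<^sub>M b\<in>B. lborel))"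
  unfolding affine_lborel_def using assms affine_chart_measurable by (rule emeasure_distr[rotated])

text \<open>
  Both sides are product measures: on a box the factor \<open>c ^ card B\<close> splits into one factor \<open>c\<close> per
  coordinate, where it is the one-dimensional change of variables.
\<close>

lemma lborel_product_affine:
  fixes s :: "'b \<Rightarrow> real"
  assumes "finite B" and "c > 0"
  shows "(\<Pi>\<^sub>M b\<in>B. lborel) =
    density (distr (\<Pi>\<^sub>M b\<in>B. lborel) (\<Pi>\<^sub>M b\<in>B. lborel) (\<lambda>f. \<lambda>b\<in>B. s b + c * f b))
      (\<lambda>_. ennreal (c ^ card B))" (is "?N = density (distr ?N ?N ?\<phi>) _")
proof (rule coordinate_lborel.PiM_eqI [OF assms(1), symmetric])
  fix A :: "'b \<Rightarrow> real set"
  assume "\<And>b. b \<in> B \<Longrightarrow> A b \<in> sets lborel"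
  then have A: "\<And>b. b \<in> B \<Longrightarrow> A b \<in> sets borel"
    by simp
  have \<phi>: "?\<phi> \<in> ?N \<rightarrow>\<^sub>M ?N"
    by measurable
  have box: "Pi\<^sub>E B A \<in> sets ?N"
    using A assms(1) by (intro sets_PiM_I_finite) auto
  have slice: "(\<lambda>x. s b + c * x) -` A b \<in> sets borel" if "b \<in> B" for b
    by (rule measurable_sets_borel[OF _ A[OF that]]) measurable
  have "?\<phi> -` Pi\<^sub>E B A \<inter> space ?N = (\<Pi>\<^sub>E b\<in>B. (\<lambda>x. s b + c * x) -` A b)"
    by (auto simp: space_PiM PiE_iff)
  then have "emeasure (distr ?N ?N ?\<phi>) (Pi\<^sub>E B A) =
      (\<Prod>b\<in>B. emeasure lborel ((\<lambda>x. s b + c * x) -` A b))"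
    using slice by (simp add: emeasure_distr[OF \<phi> box] coordinate_lborel.emeasure_PiM[OF assms(1)])
  moreover have "emeasure lborel (A b) = ennreal c * emeasure lborel ((\<lambda>x. s b + c * x) -` A b)"
    if "b \<in> B" for b
  proof -
    have "emeasure lborel (A b) =
        emeasure (density (distr lborel borel (\<lambda>x. s b + c * x)) (\<lambda>_. ennreal \<bar>c\<bar>)) (A b)"
      using assms(2) by (subst lborel_real_affine[of c "s b"]) auto
    also have "\<dots> = ennreal c * emeasure lborel ((\<lambda>x. s b + c * x) -` A b)"
      using assms(2) A[OF that] by (simp add: emeasure_density_const emeasure_distr)
    finally show ?thesis .
  qed
  then have "(\<Prod>b\<in>B. emeasure lborel (A b)) =
      ennreal (c ^ card B) * (\<Prod>b\<in>B. emeasure lborel ((\<lambda>x. s b + c * x) -` A b))"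
    using assms(2) by (simp add: prod.distrib ennreal_power)
  ultimately show "emeasure (density (distr ?N ?N ?\<phi>) (\<lambda>_. ennreal (c ^ card B))) (Pi\<^sub>E B A) =
      (\<Prod>b\<in>B. emeasure lborel (A b))"
    using box by (simp add: emeasure_density_const)
qed simp

text \<open>
  In the chart, a homothety whose centre lies in the affine subspace acts separately on the
  coordinates: if \<open>g\<close> are the coordinates of the centre, then \<open>f b\<close> becomes
  \<open>(1 - c) * g b + c * f b\<close>.
\<close>

lemma affine_lborel_homothety:
  fixes a u :: "'a::euclidean_space"
  assumes "finite B" and "c > 0" and "u - a \<in> span B" and S: "S \<in> sets borel"
  shows "emeasure (affine_lborel a B) S =
    ennreal (c ^ card B) * emeasure (affine_lborel a B) ((\<lambda>x. u + c *\<^sub>R (x - u)) -` S)"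
proof -
  let ?N = "\<Pi>\<^sub>M b\<in>B. (lborel :: real measure)"
  let ?T = "\<lambda>f. a + (\<Sum>b\<in>B. f b *\<^sub>R b)"
  obtain g where g: "u - a = (\<Sum>b\<in>B. g b *\<^sub>R b)"
    using assms(3) span_finite[OF assms(1)] by auto
  let ?\<phi> = "\<lambda>f. \<lambda>b\<in>B. (1 - c) * g b + c * f b"
  have T\<phi>: "?T (?\<phi> f) = u + c *\<^sub>R (?T f - u)" for f
  proof -
    have "?T (?\<phi> f) = a + (1 - c) *\<^sub>R (u - a) + c *\<^sub>R (?T f - a)"
      by (simp add: g scaleR_sum_right scaleR_add_left sum.distrib)
    also have "\<dots> = u + c *\<^sub>R (?T f - u)"
      by (simp add: algebra_simps)
    finally show ?thesis .
  qed
  have \<phi>: "?\<phi> \<in> ?N \<rightarrow>\<^sub>M ?N"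
    by measurable
  have X: "?T -` S \<inter> space ?N \<in> sets ?N"
    using affine_chart_measurable S by (rule measurable_sets)
  have hS: "(\<lambda>x. u + c *\<^sub>R (x - u)) -` S \<in> sets borel"
    by (rule measurable_sets_borel[OF _ S]) measurable
  have "?\<phi> -` (?T -` S \<inter> space ?N) \<inter> space ?N =
      ?T -` ((\<lambda>x. u + c *\<^sub>R (x - u)) -` S) \<inter> space ?N"
    using measurable_space[OF \<phi>] by (auto simp: T\<phi> simp del: restrict_apply)
  then have "emeasure (density (distr ?N ?N ?\<phi>) (\<lambda>_. ennreal (c ^ card B))) (?T -` S \<inter> space ?N) =
      ennreal (c ^ card B) * emeasure ?N (?T -` ((\<lambda>x. u + c *\<^sub>R (x - u)) -` S) \<inter> space ?N)"
    using X by (simp add: emeasure_density_const emeasure_distr[OF \<phi>])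
  then show ?thesis
    unfolding emeasure_affine_lborel[OF S] emeasure_affine_lborel[OF hS]
    using lborel_product_affine[OF assms(1,2), of "\<lambda>b. (1 - c) * g b"] by simp
qed

text \<open>A bounded set lies in a box, since the coordinates are inner products with unit vectors.\<close>

lemma affine_lborel_bounded_finite:
  fixes a :: "'a::euclidean_space"
  assumes "finite B" and "pairwise orthogonal B" and norm: "\<And>b. b \<in> B \<Longrightarrow> norm b = 1"
    and "bounded S" and S: "S \<in> sets borel"
  shows "emeasure (affine_lborel a B) S < \<infinity>"
proof -
  let ?N = "\<Pi>\<^sub>M b\<in>B. (lborel :: real measure)"
  obtain R where R: "\<And>x. x \<in> S \<Longrightarrow> norm x \<le> R"
    using assms(4) by (auto simp: bounded_iff)
  define r where "r = R + norm a"
  let ?Q = "\<Pi>\<^sub>E b\<in>B. {- r..r}"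
  have "f b \<in> {- r..r}" if f: "a + (\<Sum>b\<in>B. f b *\<^sub>R b) \<in> S" and b: "b \<in> B" for f b
  proof -
    define v where "v = (\<Sum>b\<in>B. f b *\<^sub>R b)"
    have "b' \<bullet> b = (if b' = b then 1 else 0)" if "b' \<in> B" for b'
      using that b assms(2) norm[OF b] by (auto simp: pairwise_def orthogonal_def norm_eq_1)
    then have "v \<bullet> b = (\<Sum>b'\<in>B. f b' * (if b' = b then 1 else 0))"
      unfolding v_def inner_sum_left by (intro sum.cong) auto
    then have "v \<bullet> b = f b"
      using assms(1) b by (simp add: mult_delta_right)
    moreover have "\<bar>v \<bullet> b\<bar> \<le> norm v"
      using Cauchy_Schwarz_ineq2[of v b] norm[OF b] by simp
    moreover have "norm v \<le> norm (a + v) + norm a"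
      using norm_triangle_ineq4[of "a + v" a] by simp
    ultimately show ?thesis
      using R[OF f] by (auto simp: r_def v_def)
  qed
  then have "(\<lambda>f. a + (\<Sum>b\<in>B. f b *\<^sub>R b)) -` S \<inter> space ?N \<subseteq> ?Q"
    by (auto simp: space_PiM PiE_iff)
  then have "emeasure (affine_lborel a B) S \<le> emeasure ?N ?Q"
    unfolding emeasure_affine_lborel[OF S]
    using assms(1) by (intro emeasure_mono sets_PiM_I_finite) auto
  also have "\<dots> = (\<Prod>b\<in>B. emeasure lborel {- r..r})"
    using assms(1) by (intro coordinate_lborel.emeasure_PiM) auto
  also have "\<dots> < \<infinity>"
    by (cases "- r \<le> r") (auto simp: power_less_top_ennreal)
  finally show ?thesis .
qed

text \<open>The relative ball contains the image of a small box around the coordinates of its centre.\<close>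

lemma affine_lborel_pos:
  fixes a u :: "'a::euclidean_space"
  assumes "finite B" and norm: "\<And>b. b \<in> B \<Longrightarrow> norm b = 1" and "u - a \<in> span B"
    and "e > 0" and S: "S \<in> sets borel"
    and ball: "\<And>x. x - u \<in> span B \<Longrightarrow> norm (x - u) \<le> e \<Longrightarrow> x \<in> S"
  shows "emeasure (affine_lborel a B) S > 0"
proof -
  let ?N = "\<Pi>\<^sub>M b\<in>B. (lborel :: real measure)"
  let ?T = "\<lambda>f. a + (\<Sum>b\<in>B. f b *\<^sub>R b)"
  obtain g where g: "u - a = (\<Sum>b\<in>B. g b *\<^sub>R b)"
    using assms(3) span_finite[OF assms(1)] by auto
  define d where "d = e / (real (card B) + 1)"
  have "d > 0"
    using assms(4) by (simp add: d_def)
  let ?Q = "\<Pi>\<^sub>E b\<in>B. {g b - d..g b + d}"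
  have "?T f \<in> S" if f: "f \<in> ?Q" for f
  proof (rule ball)
    have eq: "?T f - u = (\<Sum>b\<in>B. (f b - g b) *\<^sub>R b)"
      using g by (simp add: scaleR_diff_left sum_subtractf algebra_simps)
    show "?T f - u \<in> span B"
      unfolding eq by (intro span_sum span_scale span_base)
    have "norm (?T f - u) \<le> (\<Sum>b\<in>B. norm ((f b - g b) *\<^sub>R b))"
      unfolding eq by (rule norm_sum)
    also have "\<dots> \<le> (\<Sum>b\<in>B. d)"
      using f norm by (intro sum_mono) (fastforce simp: PiE_iff abs_le_iff)
    also have "\<dots> \<le> e"
      using assms(4) by (simp add: d_def field_simps)
    finally show "norm (?T f - u) \<le> e" .
  qed
  then have "?Q \<subseteq> ?T -` S \<inter> space ?N"
    by (auto simp: space_PiM PiE_iff)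
  then have "emeasure ?N ?Q \<le> emeasure (affine_lborel a B) S"
    unfolding emeasure_affine_lborel[OF S]
    by (rule emeasure_mono) (rule measurable_sets[OF affine_chart_measurable S])
  moreover have "emeasure ?N ?Q = (\<Prod>b\<in>B. emeasure lborel {g b - d..g b + d})"
    using assms(1) by (intro coordinate_lborel.emeasure_PiM) auto
  then have "emeasure ?N ?Q > 0"
    using \<open>d > 0\<close> by (simp add: zero_less_iff_neq_zero assms(1))
  ultimately show ?thesis
    by (rule order.strict_trans2[rotated])
qed

section \<open>Comparing the body with the simplex\<close>

text \<open>
  The relative volume picks a base point and a basis by a choice operator, so only properties
  common to all choices are available; these suffice. The number of basis vectors is bounded
  by placing them in the hyperplane of vectors with coordinate sum 0. The homothety applied
  later has ratio at most 1, so an upper bound on the exponent bounds its Jacobian from below.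
\<close>

lemma affine_volume_simplex_chart:
  obtains a :: "real ^ 'n::finite" and B :: "(real ^ 'n) set"
  where "\<And>S. affine_volume (affine hull prob_simplex) S = measure (affine_lborel a B) S"
    and "finite B" "pairwise orthogonal B" "\<And>b. b \<in> B \<Longrightarrow> norm b = 1" "card B \<le> CARD('n::finite) - 1"
    and "uniform_law - a \<in> span B" "\<And>v. v \<in> span B \<Longrightarrow> (\<Sum>i\<in>UNIV. v $ i) = 0"
proof -
  let ?A = "affine hull prob_simplex :: (real ^ 'n) set"
  define V where "V = {x - y |x y. x \<in> ?A \<and> y \<in> ?A}"
  let ?H = "{v :: real ^ 'n. 1 \<bullet> v = 0}"
  define a where "a = (SOME a. a \<in> ?A)"
  define B where "B = (SOME B. orthonormal_basis_of B V)"
  have u: "uniform_law \<in> ?A"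
    using uniform_law_in_simplex by (rule hull_inc)
  then have a: "a \<in> ?A"
    unfolding a_def by (rule someI)
  have "V = (\<lambda>x. x - a) ` ?A"
  proof (intro equalityI subsetI)
    fix v assume "v \<in> V"
    then obtain x y where xy: "v = x - y" "x \<in> ?A" "y \<in> ?A"
      by (auto simp: V_def)
    then have "1 *\<^sub>R x + (- 1) *\<^sub>R y + 1 *\<^sub>R a \<in> ?A"
      using a by (intro mem_affine_3) auto
    then show "v \<in> (\<lambda>x. x - a) ` ?A"
      using xy(1) by (intro image_eqI[of _ _ "x - y + a"]) auto
  qed (use a in \<open>auto simp: V_def\<close>)
  then have subspace: "subspace V"
    using affine_diffs_subspace_subtract[OF affine_affine_hull a] by simp
  obtain B' where "pairwise orthogonal B'" "\<And>b. b \<in> B' \<Longrightarrow> norm b = 1" "span B' = V"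
    using orthonormal_basis_subspace[OF subspace] by metis
  then have "orthonormal_basis_of B' V"
    by (simp add: orthonormal_basis_of_def)
  then have "orthonormal_basis_of B V"
    unfolding B_def by (rule someI)
  then have B: "pairwise orthogonal B" "\<And>b. b \<in> B \<Longrightarrow> norm b = 1" and span: "span B = V"
    by (auto simp: orthonormal_basis_of_def)
  have indep: "independent B"
    using B by (intro pairwise_orthogonal_independent) (auto dest: B(2))
  have zero: "(\<Sum>i\<in>UNIV. v $ i) = 0" if "v \<in> span B" for v
    using that by (auto simp: span V_def sum_subtractf affine_hull_simplex_sum)
  then have "span B \<subseteq> ?H"
    by (auto simp: inner_vec_def)
  then have "dim (span B) \<le> dim ?H"
    by (rule dim_subset)
  also have "\<dots> = CARD('n) - 1"
    by (subst dim_hyperplane) auto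
  finally have card: "card B \<le> CARD('n) - 1"
    using indep by (simp add: dim_eq_card_independent)
  show thesis
  proof (rule that)
    show "affine_volume ?A S = measure (affine_lborel a B) S" for S
      by (simp add: affine_volume_def a_def B_def V_def)
    show "uniform_law - a \<in> span B"
      unfolding span V_def using u a by blast
  qed (use B card zero independent_imp_finite[OF indep] in auto)
qed

text \<open>The coordinates of a law deviate from \<open>1 / k\<close> by strictly less than 1, so half the margin
  itself is an admissible ratio, boundary points of the simplex included.\<close>

lemma homothety_simplex_in_body:
  fixes p :: "real ^ 'n::finite"
  assumes "CARD('n) \<ge> 2" and "p \<in> prob_simplex"
  shows "uniform_law + (margin CARD('n) / 2) *\<^sub>R (p - uniform_law) \<in> body" (is "?q \<in> _")
proof (rule near_uniform_in_body')
  have c: "0 < margin CARD('n) / 2"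
    using margin_pos[OF assms(1)] by simp
  have "(\<Sum>i\<in>UNIV. (p - uniform_law) $ i) = 0"
    using assms(2) uniform_law_in_simplex[where 'n = 'n]
    by (simp add: prob_simplex_def sum_subtractf)
  then show "(\<Sum>i\<in>UNIV. ?q $ i) = 1"
    using uniform_law_in_simplex[where 'n = 'n]
    by (simp add: prob_simplex_def sum.distrib sum_distrib_left [symmetric]
        sum_divide_distrib [symmetric])
  show "\<bar>?q $ i - 1 / real CARD('n)\<bar> < margin CARD('n) / 2" for i
  proof -
    have "0 < 1 / real CARD('n)" "1 / real CARD('n) < 1"
      using assms(1) by auto
    moreover have "0 \<le> p $ i" "p $ i \<le> 1"
      using assms(2) coordinate_le_one[OF assms(2)] by (auto simp: prob_simplex_def)
    ultimately have "\<bar>p $ i - 1 / real CARD('n)\<bar> < 1"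
      by linarith
    then have "(margin CARD('n) / 2) * \<bar>p $ i - 1 / real CARD('n)\<bar> < (margin CARD('n) / 2) * 1"
      using c by (intro mult_strict_left_mono)
    then show ?thesis
      using c by (simp add: uniform_law_def abs_mult)
  qed
qed (rule assms(1))

lemma bounded_prob_simplex: "bounded (prob_simplex :: (real ^ 'n::finite) set)"
proof -
  have "norm p \<le> 1" if "p \<in> prob_simplex" for p :: "real ^ 'n"
    using that norm_le_l1_cart[of p] by (simp add: prob_simplex_def)
  then show ?thesis
    by (auto simp: bounded_iff)
qed

lemma normalized_volume_body:
  assumes "CARD('n::finite) \<ge> 2"
  shows "normalized_volume (body :: (real ^ 'n) set) \<ge> (margin CARD('n) / 2) ^ (CARD('n) - 1)"
proof -
  let ?\<Delta> = "prob_simplex :: (real ^ 'n) set"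
  let ?k = "CARD('n)"
  define c where "c = margin ?k / 2"
  have c: "0 < c"
    using margin_pos[OF assms] by (simp add: c_def)
  have "1 / real ?k \<le> 1"
    using assms by (simp add: divide_le_eq)
  then have "c \<le> 1"
    using margin_le[OF assms] unfolding c_def by linarith
  obtain a :: "real ^ 'n" and B :: "(real ^ 'n) set"
    where vol: "\<And>S. affine_volume (affine hull ?\<Delta>) S = measure (affine_lborel a B) S"
    and B: "finite B" "pairwise orthogonal B" "\<And>b. b \<in> B \<Longrightarrow> norm b = 1"
    and card: "card B \<le> ?k - 1"
    and u: "uniform_law - a \<in> span B" and zero: "\<And>v. v \<in> span B \<Longrightarrow> (\<Sum>i\<in>UNIV. v $ i) = 0"
    by (rule affine_volume_simplex_chart[where 'n = 'n]) (rule that)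
  let ?M = "affine_lborel a B"
  have borel: "?\<Delta> \<in> sets borel" "(body :: (real ^ 'n) set) \<in> sets borel"
    by (intro borel_closed closed_prob_simplex closed_body[OF assms])+
  have fin: "emeasure ?M ?\<Delta> < \<infinity>"
    using B bounded_prob_simplex borel(1) by (rule affine_lborel_bounded_finite)
  have "emeasure ?M body \<le> emeasure ?M ?\<Delta>"
    using borel by (intro emeasure_mono) (auto simp: body_def)
  with fin have fin': "emeasure ?M body < \<infinity>"
    by (rule le_less_trans[rotated])
  \<comment> \<open>The radius \<open>1 / k\<close> keeps every coordinate nonnegative.\<close>
  have "emeasure ?M ?\<Delta> > 0"
  proof (rule affine_lborel_pos[OF B(1,3) u _ borel(1)])
    fix x :: "real ^ 'n"
    assume x: "x - uniform_law \<in> span B" "norm (x - uniform_law) \<le> 1 / real ?k"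
    have "0 \<le> x $ i" for i
    proof -
      have "\<bar>x $ i - 1 / real ?k\<bar> \<le> 1 / real ?k"
        using component_le_norm_cart[of "x - uniform_law" i] x(2) by (simp add: uniform_law_def)
      then show ?thesis
        by linarith
    qed
    moreover have "(\<Sum>i\<in>UNIV. x $ i) = 1"
      using zero[OF x(1)] by (simp add: sum_subtractf uniform_law_def)
    ultimately show "x \<in> ?\<Delta>"
      by (simp add: prob_simplex_def)
  qed auto
  then have pos: "measure ?M ?\<Delta> > 0"
    using fin by (simp add: measure_def enn2real_positive_iff)
  have "ennreal (c ^ card B) * emeasure ?M ?\<Delta> \<le> ennreal (c ^ card B) *
      emeasure ?M ((\<lambda>x. uniform_law + c *\<^sub>R (x - uniform_law)) -` body)"
  proof (intro mult_left_mono emeasure_mono)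
    show "?\<Delta> \<subseteq> (\<lambda>x. uniform_law + c *\<^sub>R (x - uniform_law)) -` body"
      using homothety_simplex_in_body[OF assms] by (auto simp: c_def)
    show "(\<lambda>x. uniform_law + c *\<^sub>R (x - uniform_law)) -` body \<in> sets ?M"
      unfolding sets_affine_lborel by (rule measurable_sets_borel[OF _ borel(2)]) measurable
  qed simp
  also have "\<dots> = emeasure ?M body"
    by (rule affine_lborel_homothety[OF B(1) c u borel(2), symmetric])
  finally have "enn2real (ennreal (c ^ card B) * emeasure ?M ?\<Delta>) \<le> measure ?M body"
    unfolding measure_def using fin' by (intro enn2real_mono) auto
  then have "c ^ card B * measure ?M ?\<Delta> \<le> measure ?M body"
    using c by (simp add: enn2real_mult measure_def)
  moreover have "c ^ (?k - 1) \<le> c ^ card B"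
    using c \<open>c \<le> 1\<close> card by (intro power_decreasing) auto
  ultimately have "c ^ (?k - 1) * measure ?M ?\<Delta> \<le> measure ?M body"
    using pos by (meson mult_right_mono less_imp_le order_trans)
  then show ?thesis
    using pos by (simp add: normalized_volume_def Let_def vol c_def pos_le_divide_eq)
qed

theorem proposition2p2:
  fixes k :: nat
  assumes "CARD('n::finite) = k" and "k \<ge> 4"
  shows "margin k = (1 - 1 / real k) ^ k / (real k - 1) \<and>
    (1 - 1 / real k) ^ k / (real k - 1) = (real k - 1) ^ (k - 1) / real k ^ k \<and>
    (real k - 1) ^ (k - 1) / real k ^ k > 0 \<and>
    (\<forall>p :: real ^ 'n. p \<in> prob_simplex \<and> infnorm (p - uniform_law) < margin k / 2 \<longrightarrow> p \<in> body) \<and>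
    (uniform_law :: real ^ 'n) \<in> top_of_set prob_simplex interior_of body \<and>
    (uniform_law :: real ^ 'n) \<in> rel_interior body \<and>
    normalized_volume (body :: (real ^ 'n) set)
      \<ge> ((real k - 1) ^ (k - 1) / (2 * real k ^ k)) ^ (k - 1) \<and>
    ((real k - 1) ^ (k - 1) / (2 * real k ^ k)) ^ (k - 1) > 0"
proof (intro conjI allI impI)
  have k: "k \<ge> 2" "CARD('n) \<ge> 2"
    using assms by auto
  show "margin k = (1 - 1 / real k) ^ k / (real k - 1)"
    using k(1) by (rule margin_eq)
  show "(1 - 1 / real k) ^ k / (real k - 1) = (real k - 1) ^ (k - 1) / real k ^ k"
    using k(1) by (rule margin_closed_form)
  show "(real k - 1) ^ (k - 1) / real k ^ k > 0"
    using k(1) by simp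
  show "p \<in> body" if "p \<in> prob_simplex \<and> infnorm (p - uniform_law) < margin k / 2" for p :: "real ^ 'n"
  proof (rule near_uniform_in_body[OF k(2)])
    show "\<bar>p $ i - 1 / real CARD('n)\<bar> < margin CARD('n) / 2" for i
      using that component_le_infnorm_cart[of "p - uniform_law" i]
      by (simp add: uniform_law_def assms(1))
  qed (use that in blast)
  show "(uniform_law :: real ^ 'n) \<in> top_of_set prob_simplex interior_of body"
    by (rule uniform_law_interior_of[OF k(2)])
  show "(uniform_law :: real ^ 'n) \<in> rel_interior body"
    by (rule uniform_law_rel_interior[OF k(2)])
  have "margin k / 2 = (real k - 1) ^ (k - 1) / (2 * real k ^ k)"
    using margin_eq[OF k(1)] margin_closed_form[OF k(1)] by simp
  then show "normalized_volume (body :: (real ^ 'n) set)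
      \<ge> ((real k - 1) ^ (k - 1) / (2 * real k ^ k)) ^ (k - 1)"
    using normalized_volume_body[OF k(2)] by (simp only: assms(1))
  show "((real k - 1) ^ (k - 1) / (2 * real k ^ k)) ^ (k - 1) > 0"
    using k(1) by simp
qed

end
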